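(* If $X$ and $X'$ are isogonal conjugate points with respect to the hyperbolic triangle $ABC$ with side lengths $a=BC$, $b=CA$, $c=AB$, then their triangular coordinates satisfy $$n_A(X'):n_B(X'):n_C(X')=\frac{\sinh^2 a}{n_A(X)}:\frac{\sinh^2 b}{n_B(X)}:\frac{\sinh^2 c}{n_C(X)}.$$
   Context: Extended plane: the hyperbolic plane (with constant $k=1$) is extended, in a projective model, by points at infinity (boundary points) and ideal points (exterior points); lines are real lines, lines at infinity (with exactly one point at infinity, all others ideal) and ideal lines (all points ideal). Poles and polars are taken with respect to the boundary of the model, so the polar of an ideal point is a real line. Two points $A,B$ of a line determine two segments. Their lengths on a real line are: $d$ and $-d+\pi i$ for two real points at distance $d$; $d+\frac{\pi}{2}i$ and $-d+\frac{\pi}{2}i$ for a real and an ideal point, where $d$ is the distance of the real point from the polar of the ideal point (the sign of the real part is positive for the segment met by this polar, negative for the other); $d+\pi i$ and $-d$ for two ideal points whose polars are at distance $d$; $\infty$ and $-\infty$ if at least one of the points is at infinity. On a line at infinity they are $\frac{\pi}{2}i,\frac{\pi}{2}i$ for the point at infinity and an ideal point, and $0,\pi i$ for two ideal points; on an ideal line the length is $i$ times the angle of the polars. In general the length of a segment is $i$ times the corresponding angle of the polars of its endpoints. By convention $\cosh(\pm\infty)=\infty$, $\sinh(\pm\infty)=\pm\infty$, $\tanh(\pm\infty)=\pm1$. The points are not assumed to be real and the lengths are not assumed to be positive numbers: the formulas are meant also for ideal elements, elements at infinity and complex lengths, except where an operation occurring in the formula is not meaningful. Isogonal conjugate: reflect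 each of the lines $AX$, $BX$, $CX$ in the bisector of the angle of the triangle at $A$, $B$, $C$, respectively; the three reflected lines are concurrent, and their common point $X'$ is the isogonal conjugate of $X$. Staudtian: the Staudtian of a triangle with side lengths $u,v,w$ and $2\sigma=u+v+w$ is $\sqrt{\sinh\sigma\,\sinh(\sigma-u)\,\sinh(\sigma-v)\,\sinh(\sigma-w)}$; it equals half of $\sinh(\text{side})\cdot\sinh(\text{corresponding height})$. Triangular coordinates: with respect to the non-degenerate triangle $ABC$, a point $X$ has coordinates $n_A(X):n_B(X):n_C(X)$, where $n_A(X),n_B(X),n_C(X)$ are the Staudtians of the triangles $XBC$, $XCA$, $XAB$, taken with sign (for real elements $n_A(X)$ is positive if $X$ and $A$ are on the same side of the line $BC$ and negative if they are on opposite sides; analogously for $n_B$, $n_C$). *)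

theory Defs
  imports "HOL-Analysis.Analysis"
begin

text \<open>
  Projective model of the extended hyperbolic plane (curvature -1, i.e. k = 1).  A nonzero
  vector of \<open>\<real>\<^sup>3\<close> stands for the point with these homogeneous coordinates; the boundary
  of the model is the conic \<open>x\<^sup>2 + y\<^sup>2 = z\<^sup>2\<close>.

  Vectors, and not only points, are used because a pair of vectors \<open>p\<close>, \<open>q\<close> also selects one of the
  two segments determined by its points: the one covered by the combinations of \<open>p\<close> and \<open>q\<close> with
  nonnegative coefficients.  Replacing \<open>q\<close> by \<open>- q\<close> selects the other segment.  In the same way
  a triple of vectors selects one of the four triangles with the given vertices.
\<close>

type_synonym vec = "real^3"

definition form :: "vec \<Rightarrow> vec \<Rightarrow> real" where
  "form p q = p$1 * q$1 + p$2 * q$2 - p$3 * q$3"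

definition real_pt :: "vec \<Rightarrow> bool" where
  "real_pt p \<longleftrightarrow> form p p < 0"

definition ideal_pt :: "vec \<Rightarrow> bool" where
  "ideal_pt p \<longleftrightarrow> form p p > 0"

definition infinite_pt :: "vec \<Rightarrow> bool" where
  "infinite_pt p \<longleftrightarrow> p \<noteq> 0 \<and> form p p = 0"

text \<open>Lines (and polars) are represented by two-dimensional subspaces.\<close>

definition line :: "vec \<Rightarrow> vec \<Rightarrow> vec set" where
  "line p q = span {p, q}"

definition segm :: "vec \<Rightarrow> vec \<Rightarrow> vec set" where
  "segm p q = {s *\<^sub>R p + t *\<^sub>R q | s t. s \<ge> 0 \<and> t \<ge> 0 \<and> s + t > 0}"

definition polar :: "vec \<Rightarrow> vec set" where
  "polar p = {x. form p x = 0}"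

definition pole :: "vec \<Rightarrow> vec \<Rightarrow> vec" where
  \<comment> \<open>the pole of \<open>line p q\<close>: \<open>form (pole p q) x\<close> is the determinant of \<open>p\<close>, \<open>q\<close>, \<open>x\<close>\<close>
  "pole p q = (let n = cross3 p q in vector [n$1, n$2, - n$3])"

definition real_line :: "vec set \<Rightarrow> bool" where
  "real_line L \<longleftrightarrow> (\<exists>x\<in>L. real_pt x)"

definition line_at_infinity :: "vec set \<Rightarrow> bool" where
  "line_at_infinity L \<longleftrightarrow>
     (\<exists>x\<in>L. infinite_pt x \<and> (\<forall>y\<in>L. y \<notin> span {x} \<longrightarrow> ideal_pt y))"

definition hdist :: "vec \<Rightarrow> vec \<Rightarrow> real" where
  "hdist p q = arcosh (\<bar>form p q\<bar> / sqrt (form p p * form q q))"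

definition hdist_sets :: "vec set \<Rightarrow> vec set \<Rightarrow> real" where
  \<comment> \<open>only the real points of the two sets count\<close>
  "hdist_sets S T = Inf {hdist x y | x y. x \<in> S \<and> real_pt x \<and> y \<in> T \<and> real_pt y}"

definition polar_angle :: "vec \<Rightarrow> vec \<Rightarrow> real" where
  \<comment> \<open>angle between two intersecting real lines, given by their poles; it is the angle through which
     the polar turns while its pole runs through \<open>segm p q\<close>\<close>
  "polar_angle p q = arccos (form p q / sqrt (form p p * form q q))"

definition mixed_length :: "vec \<Rightarrow> vec \<Rightarrow> complex" where
  \<comment> \<open>\<open>p\<close> real, \<open>q\<close> ideal\<close>
  "mixed_length p q = (let d = hdist_sets {p} (polar q) in
     if segm p q \<inter> polar q \<noteq> {} then of_real d + of_real (pi / 2) * \<i>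
     else - of_real d + of_real (pi / 2) * \<i>)"

text \<open>
  Where only the two values of the length are prescribed, the value of each of the segments is
  determined by additivity along the line: of two ideal points of a real line, the segment with
  real points has length \<open>d + \<pi>\<i>\<close>; on a line at infinity, the segment through the point at infinity
  has length \<open>\<pi>\<i>\<close>.  The infinite lengths of the remaining segments with an endpoint at infinity
  are not complex numbers, and the length is left unspecified there.
\<close>

definition seg_length :: "vec \<Rightarrow> vec \<Rightarrow> complex" where
  "seg_length p q =
    (if real_pt p \<and> real_pt q then
       (if \<forall>x\<in>segm p q. real_pt x then of_real (hdist p q)
        else - of_real (hdist p q) + of_real pi * \<i>)
     else if real_pt p \<and> ideal_pt q then mixed_length p q
     else if ideal_pt p \<and> real_pt q then mixed_length q p
     else if ideal_pt p \<and> ideal_pt q then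
       (if real_line (line p q) then
          (let d = hdist_sets (polar p) (polar q) in
           if \<exists>x\<in>segm p q. real_pt x then of_real d + of_real pi * \<i> else - of_real d)
        else if line_at_infinity (line p q) then
          (if \<exists>x\<in>segm p q. infinite_pt x then of_real pi * \<i> else 0)
        else \<i> * of_real (polar_angle p q))
     else if (infinite_pt p \<and> ideal_pt q \<or> ideal_pt p \<and> infinite_pt q)
             \<and> line_at_infinity (line p q) then of_real (pi / 2) * \<i>
     else undefined)"

definition staudtian_root :: "complex \<Rightarrow> complex \<Rightarrow> complex \<Rightarrow> complex" where
  "staudtian_root u v w = (let \<sigma> = (u + v + w) / 2 in
     csqrt (sinh \<sigma> * sinh (\<sigma> - u) * sinh (\<sigma> - v) * sinh (\<sigma> - w)))"

definition foot :: "vec \<Rightarrow> vec \<Rightarrow> vec \<Rightarrow> vec \<Rightarrow> bool" where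
  \<comment> \<open>\<open>f\<close> is a foot of a perpendicular from \<open>x\<close> to \<open>line b c\<close>; the perpendiculars to a line are the
     lines through its pole\<close>
  "foot x b c f \<longleftrightarrow> f \<noteq> 0 \<and> f \<in> line b c \<and> pole b c \<in> line x f"

text \<open>
  For complex side lengths the square root in the Staudtian has no distinguished value.  It is
  fixed here by requiring that the Staudtian be half of \<open>sinh(side) * sinh(height)\<close>.  (With
  principal values this would fail, e.g. for two ideal vertices, where \<open>sinh(side)\<close> is negative
  if the side lies on a real line.)
\<close>

definition staudtian :: "vec \<Rightarrow> vec \<Rightarrow> vec \<Rightarrow> complex" where
  "staudtian x b c =
    (let r = staudtian_root (seg_length b c) (seg_length c x) (seg_length x b) in
     if \<exists>f. foot x b c f \<and> r = sinh (seg_length b c) * sinh (seg_length x f) / 2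
     then r else - r)"

definition det3 :: "vec \<Rightarrow> vec \<Rightarrow> vec \<Rightarrow> real" where
  "det3 p q r = det (vector [p, q, r] :: real^3^3)"

definition upper :: "vec \<Rightarrow> vec" where
  \<comment> \<open>real points are compared through their representatives on one sheet of the cone\<close>
  "upper p = (if real_pt p \<and> p$3 < 0 then - p else p)"

definition side_sign :: "vec \<Rightarrow> vec \<Rightarrow> vec \<Rightarrow> vec \<Rightarrow> real" where
  \<comment> \<open>1 if \<open>x\<close> and \<open>a\<close> are on the same side of \<open>line b c\<close> and -1 if they are on opposite sides. The
     complement of a line in the projective plane is connected, so if \<open>x\<close> or \<open>a\<close> is ideal this
     depends on the representing vectors: it tells whether their segment avoids \<open>line b c\<close>.\<close>
  "side_sign a b c x = sgn (det3 (upper a) b c * det3 (upper x) b c)"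

definition tri_coord :: "vec \<Rightarrow> vec \<Rightarrow> vec \<Rightarrow> vec \<Rightarrow> complex" where
  \<comment> \<open>the coordinate \<open>n\<^sub>A(X)\<close>; the other two arise by cyclic permutation of \<open>a\<close>, \<open>b\<close>, \<open>c\<close>\<close>
  "tri_coord a b c x = of_real (side_sign a b c x) * staudtian x b c"

definition same_ratio ::
  "complex \<times> complex \<times> complex \<Rightarrow> complex \<times> complex \<times> complex \<Rightarrow> bool" where
  "same_ratio = (\<lambda>(u1, u2, u3) (v1, v2, v3).
     \<exists>k. k \<noteq> 0 \<and> u1 = k * v1 \<and> u2 = k * v2 \<and> u3 = k * v3)"

definition reflection :: "vec \<Rightarrow> vec \<Rightarrow> vec" where
  \<comment> \<open>reflection in \<open>polar m\<close>, the line with pole \<open>m\<close>\<close>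
  "reflection m x = x - (2 * form x m / form m m) *\<^sub>R m"

definition angle_bisector :: "vec \<Rightarrow> vec \<Rightarrow> vec \<Rightarrow> vec \<Rightarrow> bool" where
  \<comment> \<open>\<open>polar m\<close> bisects the angle at \<open>a\<close> of the triangle \<open>a b c\<close>; the last conjunct distinguishes it
     from the bisector of the exterior angle\<close>
  "angle_bisector a b c m \<longleftrightarrow>
     form m m \<noteq> 0 \<and> a \<in> polar m \<and>
     reflection m ` line a b = line a c \<and>
     segm b c \<inter> polar m \<noteq> {}"

definition isogonal_conjugate :: "vec \<Rightarrow> vec \<Rightarrow> vec \<Rightarrow> vec \<Rightarrow> vec \<Rightarrow> bool" where
  "isogonal_conjugate a b c x x' \<longleftrightarrow> x' \<noteq> 0 \<and>
     (\<exists>m_a m_b m_c.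
        angle_bisector a b c m_a \<and> angle_bisector b c a m_b \<and> angle_bisector c a b m_c \<and>
        x' \<in> reflection m_a ` line a x \<and>
        x' \<in> reflection m_b ` line b x \<and>
        x' \<in> reflection m_c ` line c x)"

end

theory Submission
  imports Defs
begin

text \<open>
  All lengths and Staudtians have closed expressions in terms of the bilinear form, in which the
  many cases of the definition of a length disappear.  For each point \<open>p\<close> let \<open>cnorm p\<close> be the
  principal square root of \<open>form p p\<close>, which is positive for ideal points and a positive multiple
  of \<open>\<i>\<close> for real ones.  As in the spherical case, where the length would be \<open>\<i>\<close> times an
  angle, a segment satisfies
  \<open>cosh (seg_length p q) = form p q / (cnorm p * cnorm q)\<close> and
  \<open>sinh (seg_length p q) = \<i> * csqrt (gram p q) / (cnorm p * cnorm q)\<close>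
  (\<open>cosh_sinh_seg_length\<close>).  Heron's product \<open>sinh \<sigma> sinh (\<sigma> - u) sinh (\<sigma> - v) sinh (\<sigma> - w)\<close> is a
  quarter of a Gram determinant of normalized vectors, so the Staudtian of \<open>x\<close>, \<open>b\<close>, \<open>c\<close> is
  \<open>\<plusminus> (\<i> / 2) * det3 x b c / (cnorm x * cnorm b * cnorm c)\<close>; the normalization by side and
  height selects \<open>- \<i> / 2\<close> with the absolute value of the determinant, whatever the types of the
  points (\<open>staudtian_eq_det3\<close>).  The side signs restore the sign of the determinant, up to signs
  that depend on \<open>x\<close> alone or on a vertex alone (\<open>tri_coord_eq\<close>).

  What remains is projective.  The reflection in a bisector at \<open>a\<close> preserves the form and maps the
  pole of one side through \<open>a\<close> to a multiple of the pole of the other.  Hence the product of the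
  determinants of \<open>x\<close> and \<open>x'\<close> with a side, divided by the norm \<open>form n n\<close> of the pole \<open>n\<close> of that
  side, is the same for both sides through \<open>a\<close> (\<open>isogonal_lines\<close>), and so for all three sides.
  As \<open>sinh\<^sup>2\<close> of a side \<open>b c\<close> is that norm divided by \<open>form b b * form c c\<close>, the product
  \<open>n\<^sub>A(X) n\<^sub>A(X')\<close> divided by \<open>sinh\<^sup>2 a\<close> is the same for all three sides as well.
\<close>

section \<open>The quadratic form and poles\<close>

lemma form_commute: "form p q = form q p"
  by (simp add: form_def)

lemma form_linear [simp]:
  "form (x + y) z = form x z + form y z" "form z (x + y) = form z x + form z y"
  "form (x - y) z = form x z - form y z" "form z (x - y) = form z x - form z y"
  "form (c *\<^sub>R x) z = c * form x z" "form z (c *\<^sub>R x) = c * form z x"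
  "form (- x) z = - form x z" "form z (- x) = - form z x"
  "form 0 z = 0" "form z 0 = 0"
  by (simp_all add: form_def algebra_simps)

lemma pole_nth:
  "pole p q $ 1 = p$2 * q$3 - p$3 * q$2"
  "pole p q $ 2 = p$3 * q$1 - p$1 * q$3"
  "pole p q $ 3 = - (p$1 * q$2 - p$2 * q$1)"
  by (simp_all add: pole_def cross3_def Let_def)

lemma form_pole: "form (pole p q) x = det3 p q x"
  by (simp add: form_def pole_nth det3_def det_3 algebra_simps)

lemma det3_rotate: "det3 p q r = det3 q r p"
  by (simp add: det3_def det_3 algebra_simps)

lemma form_pole_args [simp]: "form (pole p q) p = 0" "form (pole p q) q = 0"
  by (simp_all add: form_pole det3_def det_3 algebra_simps)

text \<open>
  For linearly independent vectors, the sign of this Gram determinant is the type of their line: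
  negative for real lines, zero for lines at infinity, positive for ideal lines.
\<close>

definition gram :: "vec \<Rightarrow> vec \<Rightarrow> real" where
  "gram p q = form p p * form q q - (form p q)\<^sup>2"

lemma gram_commute: "gram p q = gram q p"
  by (simp add: gram_def form_commute[of q p] mult.commute)

lemma form_pole_pole: "form (pole p q) (pole p q) = - gram p q"
  by (simp add: form_def pole_nth gram_def power2_eq_square algebra_simps)

text \<open>
  If the line \<open>b c\<close> is not at infinity, this splits the space into the line and its pole.  The
  identity is multiplied by the norm of the pole so that it holds without any assumption.
\<close>

lemma pole_decomposition:
  "form (pole b c) (pole b c) *\<^sub>R x =
     form x (pole b c) *\<^sub>R pole b c
     + (form x c * form b c - form x b * form c c) *\<^sub>R b
     + (form x b * form b c - form x c * form b b) *\<^sub>R c"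
  by (simp add: vec_eq_iff forall_3 form_def pole_nth power2_eq_square, intro conjI; algebra)

text \<open>
  The Gram determinant of three vectors; the minus sign is the determinant of the form.
\<close>

lemma gram_det3:
  "form p p * form q q * form r r + 2 * form p q * form q r * form r p
     - form p p * (form q r)\<^sup>2 - form q q * (form r p)\<^sup>2 - form r r * (form p q)\<^sup>2
   = - (det3 p q r)\<^sup>2"
  unfolding det3_def det_3 form_def by simp algebra

lemma mem_line_iff: "x \<in> line p q \<longleftrightarrow> (\<exists>s t. x = s *\<^sub>R p + t *\<^sub>R q)"
proof
  assume "x \<in> line p q"
  then obtain s t where "x - s *\<^sub>R p = t *\<^sub>R q"
    unfolding line_def span_breakdown_eq by (auto simp: span_singleton)
  then show "\<exists>s t. x = s *\<^sub>R p + t *\<^sub>R q"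
    by (metis add.commute diff_add_cancel)
next
  assume "\<exists>s t. x = s *\<^sub>R p + t *\<^sub>R q"
  then show "x \<in> line p q"
    unfolding line_def by (auto intro: span_add span_scale span_base)
qed

text \<open>
  The form has only one negative direction, so it is positive on the complement of a real point.
  Every inequality between distances below rests on this, through
  \<open>reversed_Cauchy_Schwarz\<close>.
\<close>

lemma ideal_pt_if_orthogonal_to_real_pt:
  assumes "real_pt x" "form x n = 0" "n \<noteq> 0"
  shows "ideal_pt n"
proof (rule ccontr)
  assume "\<not> ideal_pt n"
  then have n: "(n$1)\<^sup>2 + (n$2)\<^sup>2 \<le> (n$3)\<^sup>2"
    by (simp add: ideal_pt_def form_def power2_eq_square)
  have x: "(x$1)\<^sup>2 + (x$2)\<^sup>2 < (x$3)\<^sup>2"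
    using assms by (simp add: real_pt_def form_def power2_eq_square)
  have "n$3 \<noteq> 0"
  proof
    assume "n$3 = 0"
    with n have "n$1 = 0 \<and> n$2 = 0"
      by (simp add: sum_power2_le_zero_iff)
    with \<open>n$3 = 0\<close> assms(3) show False by (simp add: vec_eq_iff forall_3)
  qed
  have "(x$3 * n$3)\<^sup>2 = (x$1 * n$1 + x$2 * n$2)\<^sup>2"
    using assms(2) by (simp add: form_def)
  also have "\<dots> \<le> ((x$1)\<^sup>2 + (x$2)\<^sup>2) * ((n$1)\<^sup>2 + (n$2)\<^sup>2)"
    using zero_le_power2[of "x$1 * n$2 - x$2 * n$1"] by (simp add: power2_eq_square algebra_simps)
  also have "\<dots> \<le> ((x$1)\<^sup>2 + (x$2)\<^sup>2) * (n$3)\<^sup>2"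
    using n by (intro mult_left_mono) auto
  also have "\<dots> < (x$3)\<^sup>2 * (n$3)\<^sup>2"
    using x \<open>n$3 \<noteq> 0\<close> by (intro mult_strict_right_mono) auto
  finally show False by (simp add: power_mult_distrib)
qed

lemma gram_nonpos_if_real_pt:
  assumes "real_pt x"
  shows "gram x y \<le> 0"
proof (cases "pole x y = 0")
  case True
  then show ?thesis using form_pole_pole[of x y] by simp
next
  case False
  have "ideal_pt (pole x y)"
    using ideal_pt_if_orthogonal_to_real_pt[OF assms _ False] by (simp add: form_commute[of x])
  then show ?thesis by (simp add: ideal_pt_def form_pole_pole)
qed

lemma reversed_Cauchy_Schwarz:
  assumes "real_pt y"
  shows "form x x * form y y \<le> (form x y)\<^sup>2"
  using gram_nonpos_if_real_pt[OF assms, of x] by (simp add: gram_def form_commute[of y x] mult.commute)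

lemma pole_nonzero_if_det3_nonzero: "det3 p q r \<noteq> 0 \<Longrightarrow> pole p q \<noteq> 0"
  using form_pole[of p q r] by auto

lemma pole_combination:
  "pole (s *\<^sub>R p + t *\<^sub>R q) p = (- t) *\<^sub>R pole p q"
  "pole (s *\<^sub>R p + t *\<^sub>R q) q = s *\<^sub>R pole p q"
  by (simp_all add: vec_eq_iff forall_3 pole_nth algebra_simps)

lemma combination_eq_0_iff:
  assumes "pole p q \<noteq> 0"
  shows "s *\<^sub>R p + t *\<^sub>R q = 0 \<longleftrightarrow> s = 0 \<and> t = 0"
proof
  assume "s *\<^sub>R p + t *\<^sub>R q = 0"
  then have "(- t) *\<^sub>R pole p q = pole 0 p" "s *\<^sub>R pole p q = pole 0 q"
    by (metis pole_combination)+
  moreover have "pole 0 r = 0" for r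
    by (simp add: vec_eq_iff forall_3 pole_nth)
  ultimately show "s = 0 \<and> t = 0" using assms by simp
qed simp

text \<open>
  \<open>f\<close> is the foot of the perpendicular from \<open>p\<close> to the polar of \<open>q\<close>.
\<close>

lemma form_foot:
  fixes p q :: vec
  assumes "form q q \<noteq> 0"
  defines "f \<equiv> p - (form p q / form q q) *\<^sub>R q"
  shows "form f q = 0" "form q f = 0" "form f f * form q q = gram p q" "form p f = form f f"
  using assms(1) by (simp_all add: f_def gram_def form_commute[of q p] field_simps power2_eq_square)

section \<open>Distances of points and polars\<close>

lemma hdist_arg_ge_1:
  assumes "real_pt x" "real_pt y"
  shows "\<bar>form x y\<bar> / sqrt (form x x * form y y) \<ge> 1"
proof -
  have "form x x * form y y > 0"
    using assms by (simp add: real_pt_def mult_neg_neg)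
  moreover have "sqrt (form x x * form y y) \<le> \<bar>form x y\<bar>"
    using gram_nonpos_if_real_pt[OF assms(1), of y] by (intro real_le_lsqrt) (auto simp: gram_def)
  ultimately show ?thesis by simp
qed

lemma cosh_hdist:
  assumes "real_pt x" "real_pt y"
  shows "cosh (hdist x y) = \<bar>form x y\<bar> / sqrt (form x x * form y y)" "hdist x y \<ge> 0"
  using hdist_arg_ge_1[OF assms] by (simp_all add: hdist_def)

text \<open>
  Comparing squared hyperbolic cosines turns the minimality of a distance into a polynomial
  inequality.
\<close>

lemma hdist_le_iff:
  assumes "real_pt x" "real_pt y" "real_pt x'" "real_pt y'"
  shows "hdist x y \<le> hdist x' y' \<longleftrightarrow>
    (form x y)\<^sup>2 * (form x' x' * form y' y') \<le> (form x' y')\<^sup>2 * (form x x * form y y)"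
proof -
  have pos: "form x x * form y y > 0" "form x' x' * form y' y' > 0"
    using assms by (simp_all add: real_pt_def mult_neg_neg)
  have "hdist x y \<le> hdist x' y' \<longleftrightarrow> cosh (hdist x y) \<le> cosh (hdist x' y')"
    using cosh_hdist(2)[OF assms(1,2)] cosh_hdist(2)[OF assms(3,4)]
    by (simp only: cosh_real_nonneg_le_iff)
  also have "\<dots> \<longleftrightarrow> (cosh (hdist x y))\<^sup>2 \<le> (cosh (hdist x' y'))\<^sup>2"
    by (simp add: power2_le_iff_abs_le)
  also have "\<dots> \<longleftrightarrow> (form x y)\<^sup>2 / (form x x * form y y)
      \<le> (form x' y')\<^sup>2 / (form x' x' * form y' y')"
    using pos by (simp add: cosh_hdist(1)[OF assms(1,2)] cosh_hdist(1)[OF assms(3,4)] power_divide)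
  also have "\<dots> \<longleftrightarrow>
    (form x y)\<^sup>2 * (form x' x' * form y' y') \<le> (form x' y')\<^sup>2 * (form x x * form y y)"
    using pos by (simp add: frac_le_eq divide_le_eq le_divide_eq mult_ac)
  finally show ?thesis .
qed

lemma hdist_sets_eqI:
  assumes "x \<in> S" "real_pt x" "y \<in> T" "real_pt y"
    and "\<And>x' y'. x' \<in> S \<Longrightarrow> real_pt x' \<Longrightarrow> y' \<in> T \<Longrightarrow> real_pt y' \<Longrightarrow>
      (form x y)\<^sup>2 * (form x' x' * form y' y') \<le> (form x' y')\<^sup>2 * (form x x * form y y)"
  shows "hdist_sets S T = hdist x y"
  unfolding hdist_sets_def
  by (rule cInf_eq_minimum) (use assms in \<open>auto simp: hdist_le_iff\<close>)

lemma sinh_eq_sqrt: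
  assumes "d \<ge> (0::real)"
  shows "sinh d = sqrt ((cosh d)\<^sup>2 - 1)"
  using assms by (simp add: sinh_square_eq[symmetric])

text \<open>
  The distance to the polar is attained at the foot of the perpendicular.
\<close>

lemma cosh_sinh_hdist_polar:
  assumes p: "real_pt p" and q: "ideal_pt q"
  defines "d \<equiv> hdist_sets {p} (polar q)"
  shows "cosh d = sqrt (- gram p q) / (sqrt (- form p p) * sqrt (form q q))"
    and "sinh d = \<bar>form p q\<bar> / (sqrt (- form p p) * sqrt (form q q))"
proof -
  define f where "f = p - (form p q / form q q) *\<^sub>R q"
  have qq: "form q q > 0" and pp: "form p p < 0"
    using p q by (simp_all add: real_pt_def ideal_pt_def)
  note f = form_foot[of q p, OF less_imp_neq[OF qq, symmetric], folded f_def]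
  have g: "gram p q < 0"
  proof -
    have "form p p * form q q < 0" using pp qq by (simp add: mult_neg_pos)
    then show ?thesis unfolding gram_def by (smt (verit) zero_le_power2)
  qed
  have ff: "form f f < 0"
    using f(3) g qq by (smt (verit) mult_nonneg_nonneg)
  have d: "d = hdist p f"
    unfolding d_def
  proof (rule hdist_sets_eqI)
    show "f \<in> polar q" using f by (simp add: polar_def)
    show "real_pt f" using ff by (simp only: real_pt_def)
    fix x' y assume "x' \<in> {p}" "y \<in> polar q" "real_pt y"
    then have [simp]: "x' = p" and y: "form q y = 0" "real_pt y" by (auto simp: polar_def)
    have "form f y = form p y" using y by (simp add: f_def)
    then have "form f f * form y y \<le> (form p y)\<^sup>2"
      using reversed_Cauchy_Schwarz[OF y(2), of f] by simp
    then have "(form f f * form y y) * (form p p * form f f) \<le> (form p y)\<^sup>2 * (form p p * form f f)"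
      using ff pp by (intro mult_right_mono) (auto simp: mult_nonpos_nonpos less_imp_le)
    then show "(form p f)\<^sup>2 * (form x' x' * form y y) \<le> (form x' y)\<^sup>2 * (form p p * form f f)"
      unfolding f(4) by (simp add: power2_eq_square mult_ac)
  qed (use p in auto)
  have ffq: "form f f = gram p q / form q q"
    using f(3) qq by (simp add: nonzero_eq_divide_eq)
  have d0: "d \<ge> 0" and c: "cosh d = \<bar>form f f\<bar> / sqrt (form p p * form f f)"
    using cosh_hdist[of p f] p ff d f(4) by (simp_all add: real_pt_def)
  have c2: "(cosh d)\<^sup>2 = (- gram p q) / (- form p p * form q q)"
    using ff pp qq
    by (simp add: c power_divide mult_nonpos_nonpos less_imp_le power2_eq_square) (simp add: ffq)
  have "cosh d = sqrt ((cosh d)\<^sup>2)" by simp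
  then show "cosh d = sqrt (- gram p q) / (sqrt (- form p p) * sqrt (form q q))"
    unfolding c2 by (simp only: real_sqrt_divide real_sqrt_mult real_sqrt_abs)
  have "(cosh d)\<^sup>2 - 1 = (form p q)\<^sup>2 / (- form p p * form q q)"
    unfolding c2 using pp qq by (simp add: gram_def field_simps)
  then show "sinh d = \<bar>form p q\<bar> / (sqrt (- form p p) * sqrt (form q q))"
    using sinh_eq_sqrt[OF d0] by (simp only: real_sqrt_divide real_sqrt_mult real_sqrt_abs)
qed

text \<open>
  The distance is attained on the common perpendicular of the two polars, which is the line \<open>p q\<close>
  joining the poles.
\<close>

lemma cosh_sinh_hdist_polars:
  assumes p: "ideal_pt p" and q: "ideal_pt q" and g: "gram p q < 0"
  defines "d \<equiv> hdist_sets (polar p) (polar q)"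
  shows "cosh d = \<bar>form p q\<bar> / (sqrt (form p p) * sqrt (form q q))"
    and "sinh d = sqrt (- gram p q) / (sqrt (form p p) * sqrt (form q q))"
proof -
  define x where "x = q - (form q p / form p p) *\<^sub>R p"
  define y where "y = p - (form p q / form q q) *\<^sub>R q"
  have qq: "form q q > 0" and pp: "form p p > 0"
    using p q by (simp_all add: ideal_pt_def)
  note x = form_foot[of p q, OF less_imp_neq[OF pp, symmetric], folded x_def]
  note y = form_foot[of q p, OF less_imp_neq[OF qq, symmetric], folded y_def]
  have xx: "form x x < 0"
    using x(3) g pp unfolding gram_commute[of q p] by (smt (verit) mult_nonneg_nonneg)
  have yy: "form y y < 0"
    using y(3) g qq by (smt (verit) mult_nonneg_nonneg)
  have xxq: "form x x = gram p q / form p p"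
    using x(3) pp by (simp add: gram_commute[of q p] nonzero_eq_divide_eq)
  have yyq: "form y y = gram p q / form q q"
    using y(3) qq by (simp add: nonzero_eq_divide_eq)
  have xy: "form x y = - form p q * gram p q / (form p p * form q q)"
    using pp qq by (simp add: x_def y_def gram_def form_commute[of q p] field_simps power2_eq_square)
  have xy2: "(form x y)\<^sup>2 * (form p p * form q q) = (form p q)\<^sup>2 * (form x x * form y y)"
    using pp qq by (simp only: xy xxq yyq) (simp add: field_simps power2_eq_square)
  have d: "d = hdist x y"
    unfolding d_def
  proof (rule hdist_sets_eqI)
    show "x \<in> polar p" "y \<in> polar q" using x y by (simp_all add: polar_def)
    show "real_pt x" "real_pt y" using xx yy by (simp_all only: real_pt_def)
    fix u v assume u: "u \<in> polar p" "real_pt u" and v: "v \<in> polar q" "real_pt v"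
    have pu: "form p u = 0" and qv: "form q v = 0" and uu: "form u u < 0" and vv: "form v v < 0"
      using u v by (auto simp: polar_def real_pt_def)
    \<comment> \<open>minimize over one point at a time: first \<open>v\<close> is replaced by the foot \<open>w\<close> of \<open>u\<close> on \<open>polar q\<close>,
      then \<open>u\<close> is compared with \<open>x\<close>\<close>
    define w where "w = u - (form u q / form q q) *\<^sub>R q"
    have "form w v = form u v" using qv by (simp add: w_def)
    then have 1: "form w w * form v v \<le> (form u v)\<^sup>2"
      using reversed_Cauchy_Schwarz[OF v(2), of w] by simp
    have ww: "form w w = gram u q / form q q"
      using form_foot(3)[of q u] qq by (simp add: w_def[symmetric] nonzero_eq_divide_eq)
    have "form x u = form q u" using pu by (simp add: x_def)
    then have "form x x * form u u \<le> (form u q)\<^sup>2"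
      using reversed_Cauchy_Schwarz[OF u(2), of x] by (simp add: form_commute[of q u])
    then have "gram p q * form u u \<le> (form u q)\<^sup>2 * form p p"
      unfolding xxq using pp by (simp add: field_simps)
    then have "(form p q)\<^sup>2 * (- form u u) \<le> - gram u q * form p p"
      by (simp add: gram_def algebra_simps)
    then have "(form p q)\<^sup>2 * (- form u u) * (- form v v) \<le> (- gram u q * form p p) * (- form v v)"
      using vv by (intro mult_right_mono) auto
    also have "\<dots> = (form w w * form v v) * (form p p * form q q)"
      unfolding ww using qq by simp
    also have "\<dots> \<le> (form u v)\<^sup>2 * (form p p * form q q)"
      using 1 pp qq by (intro mult_right_mono) auto
    finally have 2: "(form p q)\<^sup>2 * (form u u * form v v) \<le> (form u v)\<^sup>2 * (form p p * form q q)"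
      by (simp add: mult_ac)
    have "(form x y)\<^sup>2 * (form u u * form v v) * (form p p * form q q)
        = (form p q)\<^sup>2 * (form u u * form v v) * (form x x * form y y)"
      using xy2 by algebra
    also have "\<dots> \<le> (form u v)\<^sup>2 * (form p p * form q q) * (form x x * form y y)"
      using 2 xx yy by (intro mult_right_mono) (auto simp: mult_nonpos_nonpos less_imp_le)
    also have "\<dots> = (form u v)\<^sup>2 * (form x x * form y y) * (form p p * form q q)"
      by (simp add: mult_ac)
    finally show "(form x y)\<^sup>2 * (form u u * form v v) \<le> (form u v)\<^sup>2 * (form x x * form y y)"
      by (rule mult_right_le_imp_le) (use pp qq in simp)
  qed
  have d0: "d \<ge> 0" and c: "cosh d = \<bar>form x y\<bar> / sqrt (form x x * form y y)"
    using cosh_hdist[of x y] xx yy d by (simp_all add: real_pt_def)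
  have "(form x y)\<^sup>2 = (form p q)\<^sup>2 * (form x x * form y y) / (form p p * form q q)"
    using xy2 pp qq by (simp add: field_simps)
  then have c2: "(cosh d)\<^sup>2 = (form p q)\<^sup>2 / (form p p * form q q)"
    using xx yy unfolding c by (simp add: power_divide mult_nonpos_nonpos less_imp_le)
  have "cosh d = sqrt ((cosh d)\<^sup>2)" by simp
  then show "cosh d = \<bar>form p q\<bar> / (sqrt (form p p) * sqrt (form q q))"
    unfolding c2 by (simp only: real_sqrt_divide real_sqrt_mult real_sqrt_abs)
  have "(cosh d)\<^sup>2 - 1 = (- gram p q) / (form p p * form q q)"
    unfolding c2 using pp qq by (simp add: gram_def field_simps)
  then show "sinh d = sqrt (- gram p q) / (sqrt (form p p) * sqrt (form q q))"
    using sinh_eq_sqrt[OF d0] by (simp only: real_sqrt_divide real_sqrt_mult real_sqrt_abs)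
qed

section \<open>Hyperbolic functions of the complex lengths\<close>

text \<open>
  The principal root is a positive multiple of \<open>\<i>\<close> for real points.  This branch makes the
  formulas for the lengths uniform, including their signs.
\<close>

definition cnorm :: "vec \<Rightarrow> complex" where
  "cnorm p = csqrt (of_real (form p p))"

lemma divide_i_mult: "z / (\<i> * w) = - \<i> * (z / w)"
  by (simp flip: divide_divide_eq_left)

lemma csqrt_of_real_neg: "x < 0 \<Longrightarrow> csqrt (of_real x) = \<i> * of_real (sqrt (- x))"
  by simp

lemma csqrt_of_real_scale:
  assumes "c \<ge> 0"
  shows "csqrt (of_real (c * x)) = of_real (sqrt c) * csqrt (of_real x)"
  unfolding csqrt_of_real'
  using assms by (cases "c = 0") (auto simp: real_sqrt_mult abs_mult zero_le_mult_iff)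

lemma cnorm_real_pt: "real_pt p \<Longrightarrow> cnorm p = \<i> * of_real (sqrt (- form p p))"
  unfolding cnorm_def real_pt_def by (rule csqrt_of_real_neg)

lemma cnorm_ideal_pt: "ideal_pt p \<Longrightarrow> cnorm p = of_real (sqrt (form p p))"
  by (simp add: cnorm_def ideal_pt_def)

lemma cnorm_square: "(cnorm p)\<^sup>2 = of_real (form p p)"
  by (simp add: cnorm_def)

lemma cosh_sinh_of_real:
  "cosh (of_real d :: complex) = of_real (cosh d)" "sinh (of_real d :: complex) = of_real (sinh d)"
  by (simp_all add: cosh_def sinh_def exp_of_real scaleR_conv_of_real flip: of_real_minus)

lemma cosh_sinh_imaginary:
  "cosh (of_real t * \<i>) = of_real (cos t)" "sinh (of_real t * \<i>) = \<i> * of_real (sin t)"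
proof -
  have "\<i> * (of_real t * \<i>) = - of_real t" by (simp add: algebra_simps)
  then show "cosh (of_real t * \<i>) = of_real (cos t)" "sinh (of_real t * \<i>) = \<i> * of_real (sin t)"
    by (simp_all only: cosh_conv_cos sinh_conv_sin cos_minus sin_minus cos_of_real sin_of_real) simp
qed

lemma cosh_sinh_add_imaginary:
  "cosh (of_real d + of_real (pi / 2) * \<i>) = \<i> * of_real (sinh d)"
  "sinh (of_real d + of_real (pi / 2) * \<i>) = \<i> * of_real (cosh d)"
  "cosh (of_real d + of_real pi * \<i>) = - of_real (cosh d)"
  "sinh (of_real d + of_real pi * \<i>) = - of_real (sinh d)"
  unfolding cosh_add sinh_add cosh_sinh_of_real cosh_sinh_imaginary by simp_all

lemma cosh_sinh_hdist:
  assumes p: "real_pt p" and q: "real_pt q"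
  shows "cosh (hdist p q) = \<bar>form p q\<bar> / (sqrt (- form p p) * sqrt (- form q q))"
    and "sinh (hdist p q) = sqrt (- gram p q) / (sqrt (- form p p) * sqrt (- form q q))"
proof -
  have pp: "form p p < 0" and qq: "form q q < 0"
    using p q by (simp_all add: real_pt_def)
  have m: "sqrt (form p p * form q q) = sqrt (- form p p) * sqrt (- form q q)"
    using pp qq by (simp flip: real_sqrt_mult)
  show c: "cosh (hdist p q) = \<bar>form p q\<bar> / (sqrt (- form p p) * sqrt (- form q q))"
    using cosh_hdist(1)[OF p q] m by simp
  have "(cosh (hdist p q))\<^sup>2 - 1 = (form p q)\<^sup>2 / (form p p * form q q) - 1"
    using pp qq by (simp add: c power_divide power_mult_distrib)
  also have "\<dots> = (- gram p q) / (- form p p * - form q q)"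
    using pp qq by (simp add: gram_def diff_divide_distrib)
  finally show "sinh (hdist p q) = sqrt (- gram p q) / (sqrt (- form p p) * sqrt (- form q q))"
    using sinh_eq_sqrt[OF cosh_hdist(2)[OF p q]]
    by (simp only: real_sqrt_divide real_sqrt_mult)
qed

lemma form_combination:
  "form (s *\<^sub>R p + t *\<^sub>R q) (s *\<^sub>R p + t *\<^sub>R q) = s\<^sup>2 * form p p + 2 * (s * t) * form p q + t\<^sup>2 * form q q"
  by (simp add: form_commute[of q p] algebra_simps power2_eq_square)

lemma segmI: "s \<ge> 0 \<Longrightarrow> t \<ge> 0 \<Longrightarrow> s + t > 0 \<Longrightarrow> s *\<^sub>R p + t *\<^sub>R q \<in> segm p q"
  unfolding segm_def by blast

text \<open>
  Two vectors on the same sheet of the cone have a negative product.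
\<close>

lemma segm_real_iff:
  assumes p: "real_pt p" and q: "real_pt q"
  shows "(\<forall>x\<in>segm p q. real_pt x) \<longleftrightarrow> form p q < 0"
proof
  have pp: "form p p < 0" and qq: "form q q < 0"
    using p q by (simp_all add: real_pt_def)
  {
    assume neg: "form p q < 0"
    show "\<forall>x\<in>segm p q. real_pt x"
    proof
      fix x assume "x \<in> segm p q"
      then obtain s t where x: "x = s *\<^sub>R p + t *\<^sub>R q" and st: "s \<ge> 0" "t \<ge> 0" "s + t > 0"
        by (auto simp: segm_def)
      have "s\<^sup>2 * form p p \<le> 0" "t\<^sup>2 * form q q \<le> 0" "2 * (s * t) * form p q \<le> 0"
        using pp qq neg st by (simp_all add: mult_nonneg_nonpos)
      moreover have "s\<^sup>2 * form p p < 0 \<or> t\<^sup>2 * form q q < 0"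
        using pp qq st by (auto simp: mult_less_0_iff)
      ultimately show "real_pt x"
        unfolding real_pt_def x form_combination by linarith
    qed
  next
    assume all: "\<forall>x\<in>segm p q. real_pt x"
    let ?s = "sqrt (- form q q)" and ?t = "sqrt (- form p p)"
    have pos: "?s > 0" "?t > 0" using pp qq by simp_all
    then have "?s *\<^sub>R p + ?t *\<^sub>R q \<in> segm p q"
      by (intro segmI; linarith)
    with all have "form (?s *\<^sub>R p + ?t *\<^sub>R q) (?s *\<^sub>R p + ?t *\<^sub>R q) < 0"
      by (auto simp: real_pt_def)
    then have "(?s * ?t) * form p q < form p p * form q q"
      unfolding form_combination using pp qq by simp
    also have "\<dots> = (?s * ?t) * (?s * ?t)"
      using pp qq by (simp add: algebra_simps)
    finally have "form p q < ?s * ?t" using pos by simp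
    moreover have "?s * ?t \<le> \<bar>form p q\<bar>"
      using reversed_Cauchy_Schwarz[OF q, of p] unfolding real_sqrt_mult[symmetric]
      by (intro real_le_lsqrt) (auto simp: mult.commute)
    moreover have "?s * ?t > 0" using pos by simp
    ultimately show "form p q < 0" by linarith
  }
qed

lemma segm_meets_polar_iff:
  assumes q: "ideal_pt q"
  shows "segm p q \<inter> polar q \<noteq> {} \<longleftrightarrow> form p q \<le> 0"
proof
  have qq: "form q q > 0" using q by (simp add: ideal_pt_def)
  {
    assume le: "form p q \<le> 0"
    have "form q q *\<^sub>R p + (- form p q) *\<^sub>R q \<in> segm p q"
      by (rule segmI) (use qq le in linarith)+
    moreover have "form q q *\<^sub>R p + (- form p q) *\<^sub>R q \<in> polar q"
      by (simp add: polar_def form_commute[of q p] mult.commute)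
    ultimately show "segm p q \<inter> polar q \<noteq> {}" by blast
  next
    assume "segm p q \<inter> polar q \<noteq> {}"
    then obtain x where "x \<in> segm p q" and xq: "form q x = 0"
      unfolding polar_def by blast
    then obtain s t where st: "s \<ge> 0" "t \<ge> 0" "s + t > 0" and x: "x = s *\<^sub>R p + t *\<^sub>R q"
      unfolding segm_def by blast
    have 0: "s * form p q + t * form q q = 0"
      using xq unfolding x by (simp add: form_commute[of q p])
    show "form p q \<le> 0"
    proof (rule ccontr)
      assume pos: "\<not> form p q \<le> 0"
      then have "s * form p q \<ge> 0" "t * form q q \<ge> 0" using st qq by simp_all
      with 0 have "s * form p q = 0" "t * form q q = 0" by linarith+
      with pos qq st show False by simp
    qed
  }
qed

lemma real_line_iff:
  assumes "ideal_pt p" "pole p q \<noteq> 0"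
  shows "real_line (line p q) \<longleftrightarrow> gram p q < 0"
proof
  assume "real_line (line p q)"
  then obtain s t where r: "real_pt (s *\<^sub>R p + t *\<^sub>R q)"
    unfolding real_line_def by (auto simp: mem_line_iff)
  have "ideal_pt (pole p q)"
    by (rule ideal_pt_if_orthogonal_to_real_pt[OF r _ assms(2)]) (simp add: form_commute[of _ "pole p q"])
  then show "gram p q < 0" by (simp add: ideal_pt_def form_pole_pole)
next
  assume g: "gram p q < 0"
  have pp: "form p p > 0" using assms by (simp add: ideal_pt_def)
  let ?x = "q - (form q p / form p p) *\<^sub>R p"
  have "form ?x ?x * form p p < 0"
    using form_foot(3)[of p q] pp g by (simp add: gram_commute[of q p] del: form_linear)
  then have "real_pt ?x"
    using pp unfolding real_pt_def by (smt (verit) mult_nonneg_nonneg)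
  moreover have "?x = (- (form q p / form p p)) *\<^sub>R p + 1 *\<^sub>R q" by simp
  then have "?x \<in> line p q" unfolding mem_line_iff by blast
  ultimately show "real_line (line p q)" unfolding real_line_def by blast
qed

text \<open>
  The foot of the perpendicular from \<open>q\<close> to the polar of \<open>p\<close> is then the point at infinity of the line.
\<close>

lemma line_at_infinity_if:
  assumes p: "ideal_pt p" and "pole p q \<noteq> 0" and g: "gram p q = 0"
  shows "line_at_infinity (line p q)"
proof -
  have pp: "form p p > 0" using assms by (simp add: ideal_pt_def)
  define x where "x = q - (form q p / form p p) *\<^sub>R p"
  note f = form_foot[of p q, OF less_imp_neq[OF pp, symmetric], folded x_def]
  have q: "q = (form q p / form p p) *\<^sub>R p + x" by (simp add: x_def)
  have x: "x = (- (form q p / form p p)) *\<^sub>R p + 1 *\<^sub>R q" by (simp add: x_def)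
  have "x \<noteq> 0" unfolding x combination_eq_0_iff[OF assms(2)] by simp
  have xx: "form x x = 0" using f(3) g pp by (simp add: gram_commute[of q p])
  have "ideal_pt y" if "y \<in> line p q" "y \<notin> span {x}" for y
  proof -
    obtain s t where "y = s *\<^sub>R p + t *\<^sub>R q" using \<open>y \<in> line p q\<close> by (auto simp: mem_line_iff)
    then have y: "y = (s + t * (form q p / form p p)) *\<^sub>R p + t *\<^sub>R x" (is "y = ?r *\<^sub>R p + _")
      by (subst (asm) q) (simp add: algebra_simps)
    have "form y y = ?r\<^sup>2 * form p p"
      unfolding y form_combination using xx f(2) by simp
    moreover have "?r \<noteq> 0"
      using \<open>y \<notin> span {x}\<close> unfolding y by (auto simp: span_singleton)
    ultimately show ?thesis using pp by (simp add: ideal_pt_def)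
  qed
  moreover have "x \<in> line p q" unfolding mem_line_iff using x by blast
  ultimately show ?thesis
    using \<open>x \<noteq> 0\<close> xx unfolding line_at_infinity_def infinite_pt_def by blast
qed

text \<open>
  The form is positive definite on the line, as one sees by completing the square.
\<close>

lemma line_not_at_infinity:
  assumes p: "ideal_pt p" and g: "gram p q > 0"
  shows "\<not> line_at_infinity (line p q)"
proof
  assume "line_at_infinity (line p q)"
  then obtain x where "x \<in> line p q" and x0: "x \<noteq> 0" and xx: "form x x = 0"
    unfolding line_at_infinity_def infinite_pt_def by blast
  then obtain s t where x: "x = s *\<^sub>R p + t *\<^sub>R q" by (auto simp: mem_line_iff)
  have pp: "form p p > 0" using assms by (simp add: ideal_pt_def)
  have "(s * form p p + t * form p q)\<^sup>2 + t\<^sup>2 * gram p q = form p p * form x x"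
    unfolding x form_combination gram_def by (simp add: power2_eq_square algebra_simps)
  then have "(s * form p p + t * form p q)\<^sup>2 + t\<^sup>2 * gram p q = 0"
    using xx by simp
  moreover have "t\<^sup>2 * gram p q \<ge> 0" using g by simp
  ultimately have "(s * form p p + t * form p q)\<^sup>2 = 0" "t\<^sup>2 * gram p q = 0"
    by (smt (verit) zero_le_power2)+
  with g pp have "t = 0" "s = 0" by auto
  with x0 x show False by simp
qed

lemma cosh_sinh_seg_length_real:
  assumes p: "real_pt p" and q: "real_pt q" and n: "pole p q \<noteq> 0"
  shows "cosh (seg_length p q) = of_real (form p q) / (cnorm p * cnorm q)"
    and "sinh (seg_length p q) = \<i> * csqrt (of_real (gram p q)) / (cnorm p * cnorm q)"
proof -
  have g: "gram p q < 0"
    using ideal_pt_if_orthogonal_to_real_pt[OF p _ n] by (simp add: form_commute[of p] ideal_pt_def form_pole_pole)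
  define r where "r = sqrt (- form p p) * sqrt (- form q q)"
  have nu: "cnorm p * cnorm q = - of_real r"
    by (simp add: cnorm_real_pt p q r_def complex_eq_iff)
  note d = cosh_sinh_hdist[OF p q, folded r_def]
  have l: "seg_length p q = (if form p q < 0 then of_real (hdist p q)
      else of_real (- hdist p q) + of_real pi * \<i>)"
    using p q by (simp add: seg_length_def segm_real_iff)
  show "cosh (seg_length p q) = of_real (form p q) / (cnorm p * cnorm q)"
    unfolding l nu
    by (cases "form p q < 0")
       (simp_all only: if_True if_False cosh_sinh_of_real cosh_sinh_add_imaginary cosh_minus d, simp_all)
  show "sinh (seg_length p q) = \<i> * csqrt (of_real (gram p q)) / (cnorm p * cnorm q)"
    unfolding l nu csqrt_of_real_neg[OF g]
    by (cases "form p q < 0")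
       (simp_all only: if_True if_False cosh_sinh_of_real cosh_sinh_add_imaginary sinh_minus d, simp_all)
qed

text \<open>
  The sign of the real part of the length is opposite to that of \<open>form p q\<close>, and it turns the
  absolute value in the sine of the distance to the polar into the value \<open>- form p q\<close>.
\<close>

lemma cosh_sinh_mixed_length:
  assumes p: "real_pt p" and q: "ideal_pt q"
  shows "cosh (mixed_length p q) = of_real (form p q) / (cnorm p * cnorm q)"
    and "sinh (mixed_length p q) = \<i> * csqrt (of_real (gram p q)) / (cnorm p * cnorm q)"
proof -
  have g: "gram p q < 0"
    using p q unfolding real_pt_def ideal_pt_def gram_def
    by (smt (verit) mult_neg_pos zero_le_power2)
  define r where "r = sqrt (- form p p) * sqrt (form q q)"
  have nu: "cnorm p * cnorm q = \<i> * of_real r"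
    by (simp add: cnorm_real_pt[OF p] cnorm_ideal_pt[OF q] r_def)
  note d = cosh_sinh_hdist_polar[OF p q, folded r_def]
  have l: "mixed_length p q = of_real (if form p q \<le> 0 then hdist_sets {p} (polar q)
      else - hdist_sets {p} (polar q)) + of_real (pi / 2) * \<i>"
    unfolding mixed_length_def Let_def segm_meets_polar_iff[OF q] by simp
  show "cosh (mixed_length p q) = of_real (form p q) / (cnorm p * cnorm q)"
    unfolding l nu divide_i_mult cosh_sinh_add_imaginary by (simp add: d)
  show "sinh (mixed_length p q) = \<i> * csqrt (of_real (gram p q)) / (cnorm p * cnorm q)"
    unfolding l nu divide_i_mult csqrt_of_real_neg[OF g] cosh_sinh_add_imaginary by (simp add: d)
qed

text \<open>
  On a real line the real points lie on one of the two segments of two ideal points.  The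
  combination with coefficients \<open>sqrt (form q q)\<close> and \<open>sqrt (form p p)\<close> is the midpoint of the segment.
\<close>

lemma segm_real_point_iff:
  assumes p: "ideal_pt p" and q: "ideal_pt q" and g: "gram p q < 0"
  shows "(\<exists>x\<in>segm p q. real_pt x) \<longleftrightarrow> form p q < 0"
proof
  have pp: "form p p > 0" and qq: "form q q > 0"
    using p q by (simp_all add: ideal_pt_def)
  {
    assume "\<exists>x\<in>segm p q. real_pt x"
    then obtain s t where st: "s \<ge> 0" "t \<ge> 0"
      and "s\<^sup>2 * form p p + 2 * (s * t) * form p q + t\<^sup>2 * form q q < 0"
      unfolding segm_def real_pt_def by (auto simp only: form_combination)
    moreover have "s\<^sup>2 * form p p \<ge> 0" "t\<^sup>2 * form q q \<ge> 0" using pp qq by simp_all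
    ultimately have "(s * t) * form p q < 0" by linarith
    moreover have "s * t \<ge> 0" using st by simp
    ultimately show "form p q < 0" by (meson mult_nonneg_nonneg not_le)
  next
    assume neg: "form p q < 0"
    let ?s = "sqrt (form q q)" and ?t = "sqrt (form p p)"
    have pos: "?s > 0" "?t > 0" using pp qq by simp_all
    then have m: "?s *\<^sub>R p + ?t *\<^sub>R q \<in> segm p q"
      by (intro segmI; linarith)
    have "(?s * ?t)\<^sup>2 < (- form p q)\<^sup>2"
      using g pp qq by (simp add: gram_def power_mult_distrib mult.commute)
    then have "?s * ?t < - form p q"
      by (rule power2_less_imp_less) (use neg in simp)
    then have "(?s * ?t) * (?s * ?t) < (?s * ?t) * (- form p q)"
      using pos by (intro mult_strict_left_mono) simp_all
    moreover have "(?s * ?t) * (?s * ?t) = form p p * form q q"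
      using pp qq by (simp add: algebra_simps)
    ultimately have "form (?s *\<^sub>R p + ?t *\<^sub>R q) (?s *\<^sub>R p + ?t *\<^sub>R q) < 0"
      unfolding form_combination using pp qq by (simp add: mult.commute[of "form q q"])
    with m show "\<exists>x\<in>segm p q. real_pt x" unfolding real_pt_def by blast
  }
qed

text \<open>
  The combination with coefficients \<open>sqrt (form q q)\<close> and \<open>sqrt (form p p)\<close> is now itself the
  point at infinity if \<open>form p q\<close> is negative.
\<close>

lemma segm_infinite_point_iff:
  assumes p: "ideal_pt p" and q: "ideal_pt q" and n: "pole p q \<noteq> 0" and g: "gram p q = 0"
  shows "(\<exists>x\<in>segm p q. infinite_pt x) \<longleftrightarrow> form p q < 0"
proof
  have pp: "form p p > 0" and qq: "form q q > 0"
    using p q by (simp_all add: ideal_pt_def)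
  {
    assume "\<exists>x\<in>segm p q. infinite_pt x"
    then obtain s t where st: "s \<ge> 0" "t \<ge> 0" "s + t > 0"
      and "s\<^sup>2 * form p p + 2 * (s * t) * form p q + t\<^sup>2 * form q q = 0"
      unfolding segm_def infinite_pt_def by (auto simp only: form_combination)
    moreover have "s\<^sup>2 * form p p \<ge> 0" "t\<^sup>2 * form q q \<ge> 0" using pp qq by simp_all
    moreover have "s\<^sup>2 * form p p > 0 \<or> t\<^sup>2 * form q q > 0"
      using st pp qq by (auto simp: zero_less_mult_iff)
    ultimately have "(s * t) * form p q < 0" by linarith
    moreover have "s * t \<ge> 0" using st by simp
    ultimately show "form p q < 0" by (meson mult_nonneg_nonneg not_le)
  next
    assume neg: "form p q < 0"
    let ?s = "sqrt (form q q)" and ?t = "sqrt (form p p)"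
    have pos: "?s > 0" "?t > 0" using pp qq by simp_all
    then have m: "?s *\<^sub>R p + ?t *\<^sub>R q \<in> segm p q"
      by (intro segmI; linarith)
    have "(?s * ?t)\<^sup>2 = (- form p q)\<^sup>2"
      using g pp qq by (simp add: gram_def power_mult_distrib mult.commute)
    then have "?s * ?t = - form p q"
      by (rule power2_eq_imp_eq) (use neg pos in simp_all)
    then have "(?s * ?t) * form p q = - (form p p * form q q)"
      using g by (simp add: gram_def power2_eq_square)
    then have "form (?s *\<^sub>R p + ?t *\<^sub>R q) (?s *\<^sub>R p + ?t *\<^sub>R q) = 0"
      unfolding form_combination using pp qq by (simp add: mult.commute[of "form q q"])
    moreover have "?s *\<^sub>R p + ?t *\<^sub>R q \<noteq> 0"
      unfolding combination_eq_0_iff[OF n] using pos by simp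
    ultimately show "\<exists>x\<in>segm p q. infinite_pt x" using m unfolding infinite_pt_def by blast
  }
qed

lemma cosh_sinh_seg_length_ideal:
  assumes p: "ideal_pt p" and q: "ideal_pt q" and n: "pole p q \<noteq> 0"
  shows "cosh (seg_length p q) = of_real (form p q) / (cnorm p * cnorm q)" (is ?C)
    and "sinh (seg_length p q) = \<i> * csqrt (of_real (gram p q)) / (cnorm p * cnorm q)" (is ?S)
proof -
  have nr: "\<not> real_pt p" "\<not> real_pt q" and pp: "form p p > 0" and qq: "form q q > 0"
    using p q by (simp_all add: real_pt_def ideal_pt_def)
  consider "gram p q < 0" | "gram p q = 0" | "gram p q > 0" by linarith
  then have "?C \<and> ?S"
  proof cases
    case 1
    then show ?thesis
      using p q nr by (simp add: seg_length_def Let_def real_line_iff[OF p n] segm_real_point_iff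
        cosh_sinh_of_real cnorm_ideal_pt cosh_sinh_add_imaginary cosh_sinh_hdist_polars)
  next
    case 2
    have "sqrt (form p p) * sqrt (form q q) = sqrt ((form p q)\<^sup>2)"
      using 2 by (simp add: gram_def flip: real_sqrt_mult)
    then have m: "sqrt (form p p) * sqrt (form q q) = \<bar>form p q\<bar>" by simp
    have "form p q \<noteq> 0" using 2 pp qq by (auto simp: gram_def)
    then show ?thesis
      using p q nr 2 cosh_sinh_imaginary[of pi] m
      by (simp add: seg_length_def real_line_iff[OF p n] line_at_infinity_if segm_infinite_point_iff n
        cnorm_ideal_pt flip: of_real_mult)
  next
    case 3
    define r where "r = sqrt (form p p) * sqrt (form q q)"
    define c where "c = form p q / r"
    have r: "r > 0" and rr: "r\<^sup>2 = form p p * form q q"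
      using pp qq by (simp_all add: r_def power_mult_distrib)
    have "(form p q)\<^sup>2 = c\<^sup>2 * r\<^sup>2"
      using r by (simp add: c_def power_divide)
    then have g: "gram p q = (1 - c\<^sup>2) * r\<^sup>2"
      unfolding gram_def rr[symmetric] by (simp add: algebra_simps)
    with 3 r have "c\<^sup>2 < 1" by (simp add: zero_less_mult_iff)
    then have c1: "\<bar>c\<bar> \<le> 1" by (simp add: abs_square_less_1)
    have l: "seg_length p q = of_real (arccos c) * \<i>"
      using p q nr 3 by (simp add: seg_length_def real_line_iff[OF p n] line_not_at_infinity
          polar_angle_def real_sqrt_mult r_def c_def mult.commute)
    have nu: "cnorm p * cnorm q = of_real r"
      by (simp add: cnorm_ideal_pt p q r_def)
    have "sqrt (gram p q) = sqrt (1 - c\<^sup>2) * r"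
      unfolding g using r by (simp add: real_sqrt_mult)
    then have "sin (arccos c) = sqrt (gram p q) / r"
      using r by (simp add: sin_arccos_abs[OF c1])
    moreover have "csqrt (of_real (gram p q)) = of_real (sqrt (gram p q))"
      using 3 by simp
    ultimately show ?thesis
      unfolding l nu cosh_sinh_imaginary cos_arccos_abs[OF c1] by (simp add: c_def)
  qed
  then show ?C ?S by simp_all
qed

text \<open>
  The branches chosen in the definition of the length are exactly those for which both functions
  have one expression for all types of points and lines.
\<close>

lemma cosh_sinh_seg_length:
  assumes p: "real_pt p \<or> ideal_pt p" and q: "real_pt q \<or> ideal_pt q" and n: "pole p q \<noteq> 0"
  shows "cosh (seg_length p q) = of_real (form p q) / (cnorm p * cnorm q)" (is ?C)
    and "sinh (seg_length p q) = \<i> * csqrt (of_real (gram p q)) / (cnorm p * cnorm q)" (is ?S)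
proof -
  consider "real_pt p" "real_pt q" | "real_pt p" "ideal_pt q" | "ideal_pt p" "real_pt q"
    | "ideal_pt p" "ideal_pt q"
    using p q by blast
  then have "?C \<and> ?S"
  proof cases
    case 1
    then show ?thesis using cosh_sinh_seg_length_real[OF _ _ n] by blast
  next
    case 2
    then have "seg_length p q = mixed_length p q"
      by (simp add: seg_length_def real_pt_def ideal_pt_def)
    then show ?thesis using cosh_sinh_mixed_length[OF 2] by simp
  next
    case 3
    then have l: "seg_length p q = mixed_length q p"
      by (simp add: seg_length_def real_pt_def ideal_pt_def)
    show ?thesis
      unfolding l cosh_sinh_mixed_length[OF 3(2,1)] form_commute[of q p] gram_commute[of q p]
        mult.commute[of "cnorm q"] by simp
  next
    case 4
    then show ?thesis using cosh_sinh_seg_length_ideal[OF _ _ n] by blast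
  qed
  then show ?C ?S by simp_all
qed

text \<open>
  The one case with a point at infinity that can occur for a height: the perpendicular from an
  ideal point is a line at infinity.
\<close>

lemma sinh_seg_length_infinite:
  assumes x: "ideal_pt x" and f: "infinite_pt f" and xf: "form x f = 0"
  shows "sinh (seg_length x f) = \<i>"
proof -
  have "ideal_pt y" if "y \<in> line x f" "y \<notin> span {f}" for y
  proof -
    obtain s t where y: "y = s *\<^sub>R x + t *\<^sub>R f"
      using \<open>y \<in> line x f\<close> unfolding mem_line_iff by blast
    have "s \<noteq> 0" using \<open>y \<notin> span {f}\<close> unfolding y by (auto simp: span_singleton)
    moreover have "form y y = s\<^sup>2 * form x x"
      unfolding y form_combination using f xf by (simp add: infinite_pt_def)
    ultimately show "ideal_pt y" using x by (simp add: ideal_pt_def)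
  qed
  moreover have "f \<in> line x f" by (simp add: line_def span_base)
  ultimately have "line_at_infinity (line x f)"
    using f unfolding line_at_infinity_def by blast
  then have "seg_length x f = of_real (pi / 2) * \<i>"
    using x f by (simp add: seg_length_def real_pt_def ideal_pt_def infinite_pt_def)
  then show ?thesis by (simp only: cosh_sinh_imaginary) simp
qed

section \<open>The Staudtian as a determinant\<close>

lemma two_sinh_sinh:
  fixes x y :: complex
  shows "2 * (sinh x * sinh y) = cosh (x + y) - cosh (x - y)"
  by (simp add: cosh_add cosh_diff)

text \<open>
  Heron's formula, by two applications of the product-to-sum rule.
\<close>

lemma staudtian_root_square:
  "4 * (staudtian_root u v w)\<^sup>2 =
     1 + 2 * cosh u * cosh v * cosh w - (cosh u)\<^sup>2 - (cosh v)\<^sup>2 - (cosh w)\<^sup>2"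
proof -
  define \<sigma> where "\<sigma> = (u + v + w) / 2"
  have "4 * (staudtian_root u v w)\<^sup>2 =
      (2 * (sinh \<sigma> * sinh (\<sigma> - u))) * (2 * (sinh (\<sigma> - v) * sinh (\<sigma> - w)))"
    by (simp add: staudtian_root_def Let_def \<sigma>_def)
  also have "2 * (sinh \<sigma> * sinh (\<sigma> - u)) = cosh (v + w) - cosh u"
    unfolding two_sinh_sinh by (simp add: \<sigma>_def algebra_simps)
  also have "2 * (sinh (\<sigma> - v) * sinh (\<sigma> - w)) = cosh u - cosh (w - v)"
    unfolding two_sinh_sinh by (simp add: \<sigma>_def algebra_simps)
  also have "(cosh (v + w) - cosh u) * (cosh u - cosh (w - v)) =
      (sinh v)\<^sup>2 * (sinh w)\<^sup>2 - (cosh u - cosh v * cosh w)\<^sup>2"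
    by (simp add: cosh_add cosh_diff power2_eq_square algebra_simps)
  also have "\<dots> = 1 + 2 * cosh u * cosh v * cosh w - (cosh u)\<^sup>2 - (cosh v)\<^sup>2 - (cosh w)\<^sup>2"
    unfolding sinh_square_eq by (simp add: power2_eq_square algebra_simps)
  finally show ?thesis .
qed

text \<open>
  Write the pole of the side as \<open>s x + t f\<close>.  As \<open>f\<close> is orthogonal to the pole, this gives
  \<open>s\<^sup>2 * gram x f = form n n * form f f\<close> for the pole \<open>n\<close>, so \<open>form f f\<close> cancels from the formula
  for the sine.  A foot at infinity, where that formula is not available, gives the same value.
  Neither the choice of the foot for a pole \<open>x\<close> of the side nor the type of the foot matters.
\<close>

lemma sinh_height:
  assumes x: "real_pt x \<or> ideal_pt x" and nn: "form (pole b c) (pole b c) \<noteq> 0"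
    and f: "foot x b c f"
  shows "sinh (seg_length x f) =
    - of_real \<bar>det3 x b c\<bar> / (cnorm x * csqrt (of_real (gram b c)))"
proof -
  define n where "n = pole b c"
  obtain s t where n: "n = s *\<^sub>R x + t *\<^sub>R f"
    using f by (auto simp: foot_def mem_line_iff n_def)
  have "f \<in> line b c" and "f \<noteq> 0" using f by (simp_all add: foot_def)
  then have fn: "form f n = 0"
    unfolding mem_line_iff n_def form_commute[of f] by auto
  have nn: "form n n = s * form x n"
    using fn by (subst (1) n) simp
  with assms(2) have s: "s \<noteq> 0" and nn0: "form n n \<noteq> 0" by (auto simp: n_def)
  have xn: "\<bar>det3 x b c\<bar> = \<bar>form n n\<bar> / \<bar>s\<bar>"
    using nn s form_pole[of b c x] det3_rotate[of x b c]
    by (simp add: n_def[symmetric] form_commute[of x n] abs_mult)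
  have xf: "s * form x f = - t * form f f"
    using fn by (subst (asm) n) (simp add: form_commute[of f x])
  have xx: "s\<^sup>2 * form x x = form n n + t\<^sup>2 * form f f"
  proof -
    have "form n n = s\<^sup>2 * form x x + 2 * t * (s * form x f) + t\<^sup>2 * form f f"
      by (subst (1 2) n) (simp only: form_combination, simp add: mult_ac)
    then show ?thesis unfolding xf by (simp add: power2_eq_square algebra_simps)
  qed
  have g: "gram b c = - form n n" using form_pole_pole[of b c] by (simp add: n_def)
  have ff: "form f f > 0" if "form n n < 0"
    using ideal_pt_if_orthogonal_to_real_pt[of n f] that fn \<open>f \<noteq> 0\<close> by (simp add: real_pt_def ideal_pt_def form_commute[of n f])
  define k where "k = sqrt \<bar>form n n\<bar>"
  have k: "k > 0" and kk: "\<bar>form n n\<bar> = k\<^sup>2" using nn0 by (simp_all add: k_def)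
  \<comment> \<open>the common value of both sides if the line \<open>b c\<close> is real, up to the factor \<open>1 / cnorm x\<close>\<close>
  have unit: "- of_real (k\<^sup>2 / \<bar>s\<bar>) / (\<i> * of_real k) = \<i> * of_real (k / \<bar>s\<bar>)"
    unfolding divide_i_mult using k by (simp add: power2_eq_square)
  show ?thesis
  proof (cases "form f f = 0")
    case True
    \<comment> \<open>the perpendicular is a tangent that touches the conic at \<open>f\<close>\<close>
    have pos: "form n n > 0" using ff True nn0 by fastforce
    have "form x x = form n n / s\<^sup>2"
      using xx True s by (simp add: field_simps)
    with pos s have xi: "ideal_pt x" by (simp add: ideal_pt_def)
    have "form x f = 0" using xf True s by simp
    then have "sinh (seg_length x f) = \<i>"
      using sinh_seg_length_infinite[OF xi] True \<open>f \<noteq> 0\<close> by (simp add: infinite_pt_def)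
    moreover have "cnorm x = of_real (k / \<bar>s\<bar>)"
      unfolding cnorm_ideal_pt[OF xi] \<open>form x x = form n n / s\<^sup>2\<close> k_def
      using pos by (simp add: real_sqrt_divide)
    moreover have "csqrt (of_real (gram b c)) = \<i> * of_real k"
      unfolding g k_def using pos by simp
    ultimately have "- of_real \<bar>det3 x b c\<bar> / (cnorm x * csqrt (of_real (gram b c)))
        = \<i> * of_real (k / \<bar>s\<bar>) / of_real (k / \<bar>s\<bar>)"
      unfolding unit[symmetric] xn kk by simp
    with \<open>sinh (seg_length x f) = \<i>\<close> show ?thesis
      using k s by simp
  next
    case False
    then have fr: "real_pt f \<or> ideal_pt f" by (auto simp: real_pt_def ideal_pt_def)
    have gs: "s\<^sup>2 * gram x f = form n n * form f f"
    proof -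
      have "s\<^sup>2 * gram x f = (s\<^sup>2 * form x x) * form f f - (s * form x f)\<^sup>2"
        by (simp add: gram_def power_mult_distrib algebra_simps)
      also have "\<dots> = form n n * form f f"
        unfolding xx xf by (simp add: power2_eq_square algebra_simps)
      finally show ?thesis .
    qed
    have gxf: "gram x f = form n n * form f f / s\<^sup>2"
      using gs s by (simp add: field_simps)
    have pnz: "pole x f \<noteq> 0"
      using gs False nn0 s form_pole_pole[of x f] by auto
    have "\<i> * csqrt (of_real (gram x f)) / cnorm f
        = - of_real \<bar>det3 x b c\<bar> / csqrt (of_real (gram b c))"
    proof -
      have cf: "cnorm f \<noteq> 0" using False cnorm_square[of f] by auto
      show ?thesis
      proof (cases "form n n > 0")
        case True
        have "csqrt (of_real (gram x f)) = of_real (sqrt (form n n / s\<^sup>2)) * cnorm f"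
          unfolding cnorm_def using csqrt_of_real_scale[of "form n n / s\<^sup>2" "form f f"] True gxf by simp
        also have "sqrt (form n n / s\<^sup>2) = k / \<bar>s\<bar>"
          using True by (simp add: k_def real_sqrt_divide)
        finally have "\<i> * csqrt (of_real (gram x f)) / cnorm f = \<i> * of_real (k / \<bar>s\<bar>)"
          using cf by simp
        moreover have "csqrt (of_real (gram b c)) = \<i> * of_real k"
          unfolding g k_def using True by simp
        ultimately show ?thesis
          unfolding xn kk by (simp only: unit)
      next
        case nn_neg: False
        with nn0 have neg: "form n n < 0" by simp
        have fi: "ideal_pt f" using ff[OF neg] by (simp add: ideal_pt_def)
        have "csqrt (of_real (gram x f)) = cnorm f * csqrt (of_real (form n n / s\<^sup>2))"
          unfolding cnorm_ideal_pt[OF fi]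
          using csqrt_of_real_scale[of "form f f" "form n n / s\<^sup>2"] ff[OF neg] gxf by (simp add: mult.commute)
        also have "csqrt (of_real (form n n / s\<^sup>2)) = \<i> * of_real (sqrt (- (form n n / s\<^sup>2)))"
          using neg s by (intro csqrt_of_real_neg) (simp add: divide_neg_pos)
        also have "sqrt (- (form n n / s\<^sup>2)) = k / \<bar>s\<bar>"
          unfolding minus_divide_left real_sqrt_divide k_def using neg by simp
        finally have "\<i> * csqrt (of_real (gram x f)) / cnorm f = - of_real (k / \<bar>s\<bar>)"
          using cf by simp
        moreover have "csqrt (of_real (gram b c)) = of_real k"
          unfolding g k_def using neg by simp
        ultimately show ?thesis
          using k unfolding xn kk by (simp add: power2_eq_square)
      qed
    qed
    then show ?thesis
      unfolding cosh_sinh_seg_length(2)[OF x fr pnz]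
      by (metis (no_types) divide_divide_eq_left mult.commute)
  qed
qed

lemma projection_on_line:
  assumes nn: "form (pole b c) (pole b c) \<noteq> 0"
  shows "x - (form x (pole b c) / form (pole b c) (pole b c)) *\<^sub>R pole b c \<in> line b c"
proof -
  define n where "n = pole b c"
  define f where "f = x - (form x n / form n n) *\<^sub>R n"
  have nn: "form n n \<noteq> 0" using assms by (simp add: n_def)
  have "form n n *\<^sub>R f = form n n *\<^sub>R x - form x n *\<^sub>R n"
    using nn by (simp add: f_def scaleR_diff_right)
  also have "\<dots> = (form x c * form b c - form x b * form c c) *\<^sub>R b
       + (form x b * form b c - form x c * form b b) *\<^sub>R c"
    using pole_decomposition[of b c x] by (simp add: n_def algebra_simps)
  finally have "form n n *\<^sub>R f \<in> line b c" unfolding mem_line_iff by blast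
  then have "(1 / form n n) *\<^sub>R (form n n *\<^sub>R f) \<in> line b c"
    unfolding line_def by (rule span_scale)
  then show ?thesis using nn by (simp add: f_def n_def)
qed

text \<open>
  The projection of \<open>x\<close> to the side is a foot unless \<open>x\<close> is the pole of the side.  In that case all
  points of the side are feet.
\<close>

lemma foot_exists:
  assumes nn: "form (pole b c) (pole b c) \<noteq> 0" and x: "det3 x b c \<noteq> 0"
  shows "\<exists>f. foot x b c f"
proof -
  define n where "n = pole b c"
  have nn: "form n n \<noteq> 0" and xn: "form x n \<noteq> 0"
    using assms det3_rotate[of x b c] by (simp_all add: n_def form_pole form_commute[of x])
  define f where "f = x - (form x n / form n n) *\<^sub>R n"
  have "f \<in> line b c"
    unfolding f_def n_def using projection_on_line nn by (simp add: n_def)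
  show ?thesis
  proof (cases "f = 0")
    case False
    have "n = (form n n / form x n) *\<^sub>R x + (- form n n / form x n) *\<^sub>R f"
      using nn xn by (simp add: f_def algebra_simps)
    then have "n \<in> line x f" unfolding mem_line_iff by blast
    with False \<open>f \<in> line b c\<close> show ?thesis unfolding foot_def n_def by blast
  next
    case True
    then have "x = (form x n / form n n) *\<^sub>R n" by (simp add: f_def)
    then have "(form n n / form x n) *\<^sub>R x = (form n n / form x n) *\<^sub>R (form x n / form n n) *\<^sub>R n"
      by (rule arg_cong)
    then have "n = (form n n / form x n) *\<^sub>R x + 0 *\<^sub>R b"
      using nn xn by simp
    then have "n \<in> line x b" unfolding mem_line_iff by blast
    moreover have "b \<noteq> 0" using x by (auto simp: det3_def det_3)
    moreover have "b \<in> line b c" by (simp add: line_def span_base)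
    ultimately show ?thesis unfolding foot_def n_def by blast
  qed
qed

text \<open>
  Heron's formula determines the Staudtian up to sign, and \<open>sinh (side) * sinh (height) / 2\<close> has the
  value on the right for every foot, which fixes the sign.
\<close>

lemma staudtian_eq_det3:
  assumes x: "real_pt x \<or> ideal_pt x" and b: "real_pt b \<or> ideal_pt b" and c: "real_pt c \<or> ideal_pt c"
    and nn: "form (pole b c) (pole b c) \<noteq> 0" and d: "det3 x b c \<noteq> 0"
  shows "staudtian x b c = - (\<i> / 2) * of_real \<bar>det3 x b c\<bar> / (cnorm x * cnorm b * cnorm c)"
proof -
  define V where "V = - (\<i> / 2) * of_real \<bar>det3 x b c\<bar> / (cnorm x * cnorm b * cnorm c)"
  define r where "r = staudtian_root (seg_length b c) (seg_length c x) (seg_length x b)"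
  have nz: "cnorm x \<noteq> 0" "cnorm b \<noteq> 0" "cnorm c \<noteq> 0"
    using x b c by (auto simp: cnorm_def real_pt_def ideal_pt_def)
  have gz: "csqrt (of_real (gram b c)) \<noteq> 0"
    using nn form_pole_pole[of b c] by simp
  have p: "pole b c \<noteq> 0" "pole c x \<noteq> 0" "pole x b \<noteq> 0"
    using d pole_nonzero_if_det3_nonzero det3_rotate by metis+
  have "4 * r\<^sup>2 * ((cnorm x)\<^sup>2 * (cnorm b)\<^sup>2 * (cnorm c)\<^sup>2) = - of_real ((det3 x b c)\<^sup>2)"
  proof -
    have "4 * r\<^sup>2 * ((cnorm x)\<^sup>2 * (cnorm b)\<^sup>2 * (cnorm c)\<^sup>2) =
       (cnorm x)\<^sup>2 * (cnorm b)\<^sup>2 * (cnorm c)\<^sup>2 + 2 * of_real (form b c) * of_real (form c x) * of_real (form x b)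
        - (cnorm x)\<^sup>2 * (of_real (form b c))\<^sup>2 - (cnorm b)\<^sup>2 * (of_real (form c x))\<^sup>2 - (cnorm c)\<^sup>2 * (of_real (form x b))\<^sup>2"
      unfolding r_def staudtian_root_square
        cosh_sinh_seg_length(1)[OF b c p(1)] cosh_sinh_seg_length(1)[OF c x p(2)]
        cosh_sinh_seg_length(1)[OF x b p(3)]
      using nz by (simp add: field_simps power2_eq_square)
    also have "\<dots> = of_real (form x x * form b b * form c c + 2 * form x b * form b c * form c x
     - form x x * (form b c)\<^sup>2 - form b b * (form c x)\<^sup>2 - form c c * (form x b)\<^sup>2)"
      unfolding cnorm_square by simp
    finally show ?thesis unfolding gram_det3 by simp
  qed
  moreover have "4 * V\<^sup>2 * ((cnorm x)\<^sup>2 * (cnorm b)\<^sup>2 * (cnorm c)\<^sup>2) = - of_real ((det3 x b c)\<^sup>2)"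
    using nz by (simp add: V_def power_mult_distrib power_divide flip: of_real_power)
  ultimately have "4 * ((cnorm x)\<^sup>2 * (cnorm b)\<^sup>2 * (cnorm c)\<^sup>2) * r\<^sup>2
       = 4 * ((cnorm x)\<^sup>2 * (cnorm b)\<^sup>2 * (cnorm c)\<^sup>2) * V\<^sup>2"
    by (simp add: mult_ac)
  then have "r\<^sup>2 = V\<^sup>2" using nz by simp
  then have r: "r = V \<or> r = - V" by (simp add: power2_eq_iff)
  have sh: "sinh (seg_length b c) * sinh (seg_length x f) / 2 = V" if "foot x b c f" for f
    unfolding cosh_sinh_seg_length(2)[OF b c p(1)] sinh_height[OF x nn that] V_def
    using nz gz by (simp add: field_simps)
  obtain f0 where f0: "foot x b c f0" using foot_exists[OF nn d] by blast
  have iff: "(\<exists>f. foot x b c f \<and> r = sinh (seg_length b c) * sinh (seg_length x f) / 2) \<longleftrightarrow> r = V"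
    using f0 sh by metis
  have "staudtian x b c = (if r = V then r else - r)"
    unfolding staudtian_def Let_def r_def[symmetric] iff ..
  also have "\<dots> = V" using r by auto
  finally show ?thesis by (simp add: V_def)
qed

section \<open>Isogonal lines\<close>

lemma form_reflection: "form (reflection m x) (reflection m y) = form x y"
  by (cases "form m m = 0")
     (simp_all add: reflection_def form_commute[of m x] form_commute[of m y] field_simps power2_eq_square)

lemma reflection_reflection:
  assumes "form m m \<noteq> 0"
  shows "reflection m (reflection m x) = x"
  using assms by (simp add: reflection_def algebra_simps)

text \<open>
  A reflection preserves the form, hence the image of the pole is orthogonal to the image of
  the line.
\<close>

lemma reflection_pole:
  assumes m: "form m m \<noteq> 0" and img: "reflection m ` line a b = line a c"
    and nn: "form (pole a c) (pole a c) \<noteq> 0"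
  shows "\<exists>k. reflection m (pole a b) = k *\<^sub>R pole a c"
proof -
  let ?v = "reflection m (pole a b)"
  have orth: "form ?v y = 0" if "y \<in> line a c" for y
  proof -
    from that obtain z where z: "z \<in> line a b" and y: "y = reflection m z"
      using img by blast
    from z show ?thesis unfolding y form_reflection mem_line_iff by auto
  qed
  have "form ?v a = 0" "form ?v c = 0"
    by (rule orth; simp add: line_def span_base)+
  then have "form (pole a c) (pole a c) *\<^sub>R ?v = form ?v (pole a c) *\<^sub>R pole a c"
    using pole_decomposition[of a c ?v] by simp
  then have "(1 / form (pole a c) (pole a c)) *\<^sub>R form (pole a c) (pole a c) *\<^sub>R ?v
      = (1 / form (pole a c) (pole a c)) *\<^sub>R form ?v (pole a c) *\<^sub>R pole a c"
    by (rule arg_cong)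
  then have "?v = (form ?v (pole a c) / form (pole a c) (pole a c)) *\<^sub>R pole a c"
    using nn by simp
  then show ?thesis ..
qed

text \<open>
  Let \<open>k\<close> be the factor by which the reflection maps the pole of \<open>a b\<close> to that of \<open>a c\<close>.  For a point
  \<open>x'\<close> of the reflected line, the products with the two poles are those of \<open>x\<close> exchanged and
  scaled by \<open>k\<close> and \<open>1 / k\<close>, while \<open>k\<^sup>2\<close> is the ratio of the norms of the poles.
\<close>

lemma isogonal_lines:
  assumes m: "form m m \<noteq> 0" and img: "reflection m ` line a b = line a c"
    and nc: "form (pole a c) (pole a c) \<noteq> 0"
    and x': "x' \<in> reflection m ` line a x"
  shows "det3 a b x * det3 a b x' * form (pole a c) (pole a c)
       = det3 a c x * det3 a c x' * form (pole a b) (pole a b)"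
proof -
  obtain k where k: "reflection m (pole a b) = k *\<^sub>R pole a c"
    using reflection_pole[OF m img nc] by blast
  have kk: "form (pole a b) (pole a b) = k\<^sup>2 * form (pole a c) (pole a c)"
    using form_reflection[of m "pole a b" "pole a b"] unfolding k by (simp add: power2_eq_square)
  have k': "k *\<^sub>R reflection m (pole a c) = pole a b"
  proof -
    have "k *\<^sub>R reflection m (pole a c) = reflection m (k *\<^sub>R pole a c)"
      by (simp add: reflection_def algebra_simps)
    then show ?thesis unfolding k[symmetric] reflection_reflection[OF m] .
  qed
  obtain s t where y: "x' = reflection m (s *\<^sub>R a + t *\<^sub>R x)"
    using x' by (auto simp: mem_line_iff)
  have refl: "form z x' = form (reflection m z) (s *\<^sub>R a + t *\<^sub>R x)" for z
    unfolding y using form_reflection[of m "reflection m z"] reflection_reflection[OF m] by metis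
  have 1: "form (pole a b) x' = k * t * form (pole a c) x"
    unfolding refl k by simp
  have "k * form (pole a c) x' = form (k *\<^sub>R reflection m (pole a c)) (s *\<^sub>R a + t *\<^sub>R x)"
    unfolding refl by (simp add: algebra_simps)
  then have 2: "k * form (pole a c) x' = t * form (pole a b) x"
    unfolding k' by simp
  have "form (pole a b) x * form (pole a b) x' = k * form (pole a c) x * (t * form (pole a b) x)"
    unfolding 1 by (simp add: mult_ac)
  also have "\<dots> = form (pole a c) x * form (pole a c) x' * k\<^sup>2"
    unfolding 2[symmetric] by (simp add: power2_eq_square)
  finally show ?thesis
    unfolding kk form_pole[symmetric] by (simp add: mult_ac)
qed

section \<open>Triangular coordinates of isogonal conjugates\<close>

definition sheet_sign :: "vec \<Rightarrow> real" where
  "sheet_sign p = (if real_pt p \<and> p$3 < 0 then - 1 else 1)"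

lemma upper_eq: "upper p = sheet_sign p *\<^sub>R p"
  by (simp add: upper_def sheet_sign_def)

lemma det3_scaleR: "det3 (k *\<^sub>R p) q r = k * det3 p q r"
  by (simp add: det3_def det_3 algebra_simps)

text \<open>
  The side sign contains the sign of the determinant of \<open>x\<close>, \<open>b\<close>, \<open>c\<close> and thus removes the absolute
  value from the Staudtian.
\<close>

lemma tri_coord_eq:
  assumes x: "real_pt x \<or> ideal_pt x" and b: "real_pt b \<or> ideal_pt b" and c: "real_pt c \<or> ideal_pt c"
    and nn: "form (pole b c) (pole b c) \<noteq> 0" and d: "det3 x b c \<noteq> 0"
  shows "tri_coord a b c x = - (\<i> / 2) *
    of_real (sheet_sign a * sheet_sign x * sgn (det3 a b c) * det3 x b c) / (cnorm x * cnorm b * cnorm c)"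
proof -
  have "sgn (sheet_sign a) = sheet_sign a" "sgn (sheet_sign x) = sheet_sign x"
    by (simp_all add: sheet_sign_def)
  then have "side_sign a b c x * \<bar>det3 x b c\<bar> = sheet_sign a * sheet_sign x * sgn (det3 a b c) * det3 x b c"
    unfolding side_sign_def upper_eq det3_scaleR sgn_mult
    by (auto simp: abs_sgn mult_ac)
  then have "of_real (sheet_sign a * sheet_sign x * sgn (det3 a b c) * det3 x b c)
     = (of_real (side_sign a b c x) * of_real \<bar>det3 x b c\<bar> :: complex)"
    by (metis of_real_mult)
  then show ?thesis
    unfolding tri_coord_def staudtian_eq_det3[OF x b c nn d] by (simp add: mult_ac)
qed

lemma sinh_side_square:
  assumes "real_pt b \<or> ideal_pt b" "real_pt c \<or> ideal_pt c" "pole b c \<noteq> 0"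
  shows "(sinh (seg_length b c))\<^sup>2 = of_real (form (pole b c) (pole b c)) / ((cnorm b)\<^sup>2 * (cnorm c)\<^sup>2)"
  unfolding cosh_sinh_seg_length(2)[OF assms] form_pole_pole
  by (simp add: power_mult_distrib power_divide)

text \<open>
  Up to a factor that depends on the two points only, the product of their coordinates is the
  square of the sine of the side, once their determinants are in the ratio given by the isogonal
  condition.  The signs coming from the vertex and from the orientation of the triangle occur
  squared.
\<close>

lemma tri_coord_product:
  assumes x: "real_pt x \<or> ideal_pt x" and x': "real_pt x' \<or> ideal_pt x'"
    and b: "real_pt b \<or> ideal_pt b" and c: "real_pt c \<or> ideal_pt c"
    and nn: "form (pole b c) (pole b c) \<noteq> 0"
    and d: "det3 x b c \<noteq> 0" "det3 x' b c \<noteq> 0" "det3 a b c \<noteq> 0"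
    and q: "det3 x b c * det3 x' b c = q * form (pole b c) (pole b c)"
  shows "tri_coord a b c x' =
    (- of_real (sheet_sign x * sheet_sign x' * q) / (4 * cnorm x * cnorm x'))
      * ((sinh (seg_length b c))\<^sup>2 / tri_coord a b c x)"
proof -
  have ss: "sheet_sign a * sheet_sign a = 1" "sgn (det3 a b c) * sgn (det3 a b c) = 1"
    using d by (simp_all add: sheet_sign_def flip: sgn_mult)
  have nz: "cnorm p \<noteq> 0" if "real_pt p \<or> ideal_pt p" for p
    using that by (auto simp: cnorm_def real_pt_def ideal_pt_def)
  define e where "e = sheet_sign a * sgn (det3 a b c)"
  have "e * e = 1"
    using ss by (simp add: e_def algebra_simps)
  then have e: "of_real e * (of_real e * z) = z" for z :: complex
    by (simp flip: mult.assoc of_real_mult)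
  have t: "tri_coord a b c y = - (\<i> / 2) * (of_real e * (of_real (sheet_sign y * det3 y b c)
      / (cnorm y * cnorm b * cnorm c)))"
    if "real_pt y \<or> ideal_pt y" "det3 y b c \<noteq> 0" for y
    unfolding tri_coord_eq[OF that(1) b c nn that(2)] e_def by (simp add: mult_ac)
  have "tri_coord a b c x' * tri_coord a b c x =
    - (1 / 4) * (of_real e * (of_real e * (of_real (sheet_sign x * sheet_sign x' * (det3 x b c * det3 x' b c))
    / (cnorm x * cnorm x' * (cnorm b)\<^sup>2 * (cnorm c)\<^sup>2))))"
    unfolding t[OF x d(1)] t[OF x' d(2)] by (simp add: power2_eq_square mult_ac)
  also have "\<dots> = (- of_real (sheet_sign x * sheet_sign x' * q) / (4 * cnorm x * cnorm x'))
      * (of_real (form (pole b c) (pole b c)) / ((cnorm b)\<^sup>2 * (cnorm c)\<^sup>2))"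
    unfolding e q by (simp add: mult_ac)
  also have "of_real (form (pole b c) (pole b c)) / ((cnorm b)\<^sup>2 * (cnorm c)\<^sup>2) = (sinh (seg_length b c))\<^sup>2"
    using sinh_side_square[OF b c] nn by fastforce
  finally have "tri_coord a b c x' * tri_coord a b c x =
    (- of_real (sheet_sign x * sheet_sign x' * q) / (4 * cnorm x * cnorm x')) * (sinh (seg_length b c))\<^sup>2" .
  moreover have "tri_coord a b c x \<noteq> 0"
    unfolding tri_coord_eq[OF x b c nn d(1)]
    using d nz[OF x] nz[OF b] nz[OF c] by (simp add: sheet_sign_def sgn_zero_iff)
  moreover have "u = k * (v / w)" if "u * w = k * v" "w \<noteq> 0" for u v w k :: complex
    using that by (simp add: field_simps)
  ultimately show ?thesis by blast
qed

text \<open>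
  If the pole lies on the conic, the line is a tangent.  A tangent contains no real point, so \<open>b\<close>
  would be an ideal point of a line at infinity.
\<close>

lemma side_pole_not_null:
  assumes b: "real_pt b \<or> ideal_pt b" and n: "pole b c \<noteq> 0"
    and "\<not> line_at_infinity (line b c)"
  shows "form (pole b c) (pole b c) \<noteq> 0"
proof (cases "real_pt b")
  case True
  have "ideal_pt (pole b c)"
    by (rule ideal_pt_if_orthogonal_to_real_pt[OF True _ n]) (simp add: form_commute[of b])
  then show ?thesis by (simp add: ideal_pt_def)
next
  case False
  with b have "ideal_pt b" by blast
  then show ?thesis
    using line_at_infinity_if[OF _ n] assms(3) by (auto simp: form_pole_pole)
qed

lemma det3_nonzero_if_not_on_line:
  assumes nn: "form (pole b c) (pole b c) \<noteq> 0" and "x \<notin> line b c"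
  shows "det3 x b c \<noteq> 0"
proof
  assume "det3 x b c = 0"
  then have "form x (pole b c) = 0"
    using det3_rotate[of x b c] form_pole[of b c x] by (simp add: form_commute[of x])
  then show False using projection_on_line[OF nn, of x] assms(2) by simp
qed

lemma eq_0_if_det3_zero:
  assumes "det3 a b c \<noteq> 0" "det3 x b c = 0" "det3 x c a = 0" "det3 x a b = 0"
  shows "x = 0"
proof -
  have "det3 a b c *\<^sub>R x = det3 x b c *\<^sub>R a + det3 x c a *\<^sub>R b + det3 x a b *\<^sub>R c"
    by (simp add: vec_eq_iff forall_3 det3_def det_3, intro conjI; algebra)
  then show ?thesis using assms by simp
qed

theorem lemma2p4:
  fixes A B C X X' :: vec
  assumes "real_pt A \<or> ideal_pt A" "real_pt B \<or> ideal_pt B" "real_pt C \<or> ideal_pt C"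
    and "real_pt X \<or> ideal_pt X" "real_pt X' \<or> ideal_pt X'"
    and "det3 A B C \<noteq> 0"
    and "\<not> line_at_infinity (line B C)" "\<not> line_at_infinity (line C A)"
        "\<not> line_at_infinity (line A B)"
    and "X \<notin> line B C" "X \<notin> line C A" "X \<notin> line A B"
    and "isogonal_conjugate A B C X X'"
  defines "a \<equiv> seg_length B C" and "b \<equiv> seg_length C A" and "c \<equiv> seg_length A B"
    and "nA \<equiv> tri_coord A B C" and "nB \<equiv> tri_coord B C A" and "nC \<equiv> tri_coord C A B"
  shows "same_ratio (nA X', nB X', nC X')
           ((sinh a)\<^sup>2 / nA X, (sinh b)\<^sup>2 / nB X, (sinh c)\<^sup>2 / nC X)"
proof -
  note pts = assms(1-5)
  let ?pA = "form (pole B C) (pole B C)" and ?pB = "form (pole C A) (pole C A)"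
    and ?pC = "form (pole A B) (pole A B)"
  let ?qA = "det3 X B C * det3 X' B C" and ?qB = "det3 X C A * det3 X' C A"
    and ?qC = "det3 X A B * det3 X' A B"
  have dABC: "det3 A B C \<noteq> 0" "det3 B C A \<noteq> 0" "det3 C A B \<noteq> 0"
    using assms(6) det3_rotate by metis+
  have pA: "?pA \<noteq> 0"
    by (rule side_pole_not_null[OF assms(2) pole_nonzero_if_det3_nonzero[OF dABC(2)] assms(7)])
  have pB: "?pB \<noteq> 0"
    by (rule side_pole_not_null[OF assms(3) pole_nonzero_if_det3_nonzero[OF dABC(3)] assms(8)])
  have pC: "?pC \<noteq> 0"
    by (rule side_pole_not_null[OF assms(1) pole_nonzero_if_det3_nonzero[OF dABC(1)] assms(9)])
  note X = det3_nonzero_if_not_on_line[OF pA assms(10)] det3_nonzero_if_not_on_line[OF pB assms(11)]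
    det3_nonzero_if_not_on_line[OF pC assms(12)]
  \<comment> \<open>exchanging the endpoints of a side changes the sign of its pole, and the pole enters
    quadratically\<close>
  have swap: "form (pole q p) (pole q p) = form (pole p q) (pole p q)" for p q
    by (simp add: form_pole_pole gram_commute[of q p])
  have rot: "det3 p q r = det3 r p q" for p q r by (metis det3_rotate)
  have dswap: "det3 p q r * det3 p q s = det3 r q p * det3 s q p" for p q r s
    by (simp add: det3_def det_3 algebra_simps)
  from assms(13) obtain mA mB where X'0: "X' \<noteq> 0"
    and mA: "form mA mA \<noteq> 0" "reflection mA ` line A B = line A C" "X' \<in> reflection mA ` line A X"
    and mB: "form mB mB \<noteq> 0" "reflection mB ` line B C = line B A" "X' \<in> reflection mB ` line B X"
    unfolding isogonal_conjugate_def angle_bisector_def by blast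
  \<comment> \<open>each bisector compares the two sides through its vertex, so two of them link all three sides\<close>
  have eA: "?qC * ?pB = ?qB * ?pC"
    using isogonal_lines[OF mA(1,2) _ mA(3)] pB
    unfolding swap[of A C] dswap[of A C] rot[of A B] by (simp add: mult_ac)
  have eB: "?qA * ?pC = ?qC * ?pA"
    using isogonal_lines[OF mB(1,2) _ mB(3)] pC
    unfolding swap[of B A] dswap[of B A] rot[of B C] by (simp add: mult_ac)
  define q where "q = ?qA / ?pA"
  have qA: "?qA = q * ?pA" using pA by (simp add: q_def)
  have qC: "?qC = q * ?pC" using eB pA pC by (simp add: q_def field_simps)
  have qB: "?qB = q * ?pB" using eA pC unfolding qC by simp
  have "q \<noteq> 0"
  proof
    assume "q = 0"
    then have "det3 X' B C = 0" "det3 X' C A = 0" "det3 X' A B = 0"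
      using qA qB qC X by simp_all
    then show False using eq_0_if_det3_zero[OF dABC(1)] X'0 by blast
  qed
  then have X': "det3 X' B C \<noteq> 0" "det3 X' C A \<noteq> 0" "det3 X' A B \<noteq> 0"
    using qA qB qC pA pB pC by auto
  let ?k = "- of_real (sheet_sign X * sheet_sign X' * q) / (4 * cnorm X * cnorm X')"
  have "?k \<noteq> 0"
    using pts \<open>q \<noteq> 0\<close> by (auto simp: sheet_sign_def cnorm_def real_pt_def ideal_pt_def)
  moreover have "nA X' = ?k * ((sinh a)\<^sup>2 / nA X)"
    unfolding nA_def a_def by (rule tri_coord_product) (use pts pA X X' dABC qA in auto)
  moreover have "nB X' = ?k * ((sinh b)\<^sup>2 / nB X)"
    unfolding nB_def b_def by (rule tri_coord_product) (use pts pB X X' dABC qB in auto)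
  moreover have "nC X' = ?k * ((sinh c)\<^sup>2 / nC X)"
    unfolding nC_def c_def by (rule tri_coord_product) (use pts pC X X' dABC qC in auto)
  ultimately show ?thesis
    unfolding same_ratio_def by blast
qed

end
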